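(* For every integer $n \ge 5$, let $X_n$ be the Cayley graph of the symmetric group $S_n$ with respect to the generating set $S=\{(1,2),(2,3),\ldots,(n-1,n),(n,1)\}$ of $n$ cyclically adjacent transpositions (the modified bubble-sort graph of dimension $n$). Then the full automorphism group $\mathrm{Aut}(X_n)$ is isomorphic to the direct product $S_n \times D_{2n}$, where $D_{2n}$ is the dihedral group of order $2n$.
   Context: For a group $H$ and a subset $S \subseteq H$ with $1 \notin S = S^{-1}$, the Cayley graph $\mathrm{Cay}(H,S)$ is the simple undirected graph with vertex set $H$ in which $h$ and $sh$ are adjacent for all $h \in H$, $s \in S$. The automorphism group of a graph is the group of all permutations of its vertex set preserving adjacency. *)

theory Defs
  imports "HOL-Algebra.Sym_Groups" "HOL-Algebra.Bij" "Graph_Theory.Pair_Digraph"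
begin

text \<open>A simple undirected graph is represented, as in \<^theory>\<open>Graph_Theory.Pair_Digraph\<close>, by a
  vertex set together with a symmetric irreflexive adjacency relation.\<close>

definition cayley_graph :: "('a, 'b) monoid_scheme \<Rightarrow> 'a set \<Rightarrow> 'a pair_pre_digraph" where
  "cayley_graph H S =
     \<lparr>pverts = carrier H, parcs = {(h, s \<otimes>\<^bsub>H\<^esub> h) | h s. h \<in> carrier H \<and> s \<in> S}\<rparr>"

definition graph_automorphisms :: "'a pair_pre_digraph \<Rightarrow> ('a \<Rightarrow> 'a) set" where
  "graph_automorphisms X =
     {f \<in> Bij (pverts X). \<forall>u \<in> pverts X. \<forall>v \<in> pverts X.
        (u, v) \<in> parcs X \<longleftrightarrow> (f u, f v) \<in> parcs X}"

definition graph_aut_group :: "'a pair_pre_digraph \<Rightarrow> ('a \<Rightarrow> 'a) monoid" where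
  "graph_aut_group X = BijGroup (pverts X)\<lparr>carrier := graph_automorphisms X\<rparr>"

definition cyclic_adjacent_transpositions :: "nat \<Rightarrow> (nat \<Rightarrow> nat) set" where
  "cyclic_adjacent_transpositions n =
     {transpose i (i + 1) | i. 1 \<le> i \<and> i < n} \<union> {transpose n 1}"

definition modified_bubble_sort_graph :: "nat \<Rightarrow> (nat \<Rightarrow> nat) pair_pre_digraph" where
  "modified_bubble_sort_graph n =
     cayley_graph (sym_group n) (cyclic_adjacent_transpositions n)"

text \<open>The dihedral group of order \<open>2 * n\<close> as the semidirect product of the integers modulo \<open>n\<close>
  with a group of order two acting by negation: \<open>(x, e)\<close> stands for the rotation \<open>r ^ x\<close> if
  \<open>e\<close> is false and for the reflection \<open>r ^ x * s\<close> if \<open>e\<close> is true, where \<open>s * r = r\<inverse> * s\<close>.\<close>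

definition dihedral_group :: "nat \<Rightarrow> (int \<times> bool) monoid" where
  "dihedral_group n =
     \<lparr>carrier = {0..<int n} \<times> UNIV,
      mult = (\<lambda>(x, e) (y, d). ((if e then x - y else x + y) mod int n, e \<noteq> d)),
      one = (0, False)\<rparr>"

lemma group_dihedral_group:
  assumes "n \<ge> 1"
  shows "group (dihedral_group n)"
proof (rule groupI)
  fix x y z
  assume "x \<in> carrier (dihedral_group n)" "y \<in> carrier (dihedral_group n)"
    "z \<in> carrier (dihedral_group n)"
  then show "x \<otimes>\<^bsub>dihedral_group n\<^esub> y \<otimes>\<^bsub>dihedral_group n\<^esub> z =
      x \<otimes>\<^bsub>dihedral_group n\<^esub> (y \<otimes>\<^bsub>dihedral_group n\<^esub> z)"
    by (cases x; cases y; cases z) (auto simp: dihedral_group_def mod_simps algebra_simps)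
next
  fix x
  assume "x \<in> carrier (dihedral_group n)"
  then obtain a e where x: "x = (a, e)" and a: "0 \<le> a" "a < int n"
    by (auto simp: dihedral_group_def)
  define y where "y = (if e then x else ((- a) mod int n, False))"
  have "y \<in> carrier (dihedral_group n)"
    using assms a by (simp add: y_def x dihedral_group_def)
  moreover have "y \<otimes>\<^bsub>dihedral_group n\<^esub> x = \<one>\<^bsub>dihedral_group n\<^esub>"
    by (simp add: y_def x dihedral_group_def mod_add_left_eq)
  ultimately show "\<exists>y\<in>carrier (dihedral_group n).
      y \<otimes>\<^bsub>dihedral_group n\<^esub> x = \<one>\<^bsub>dihedral_group n\<^esub>"
    by blast
qed (use assms in \<open>auto simp: dihedral_group_def\<close>)

lemma order_dihedral_group: "order (dihedral_group n) = 2 * n"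
  by (simp add: order_def dihedral_group_def card_cartesian_product)

lemma group_graph_aut_group: "group (graph_aut_group X)"
proof -
  have "subgroup (graph_automorphisms X) (BijGroup (pverts X))"
  proof (rule group.subgroupI[OF group_BijGroup])
    show "graph_automorphisms X \<subseteq> carrier (BijGroup (pverts X))"
      by (auto simp: graph_automorphisms_def BijGroup_def)
    have "(\<lambda>x \<in> pverts X. x) \<in> graph_automorphisms X"
      by (auto simp: graph_automorphisms_def id_Bij)
    then show "graph_automorphisms X \<noteq> {}" by blast
  next
    fix f assume f: "f \<in> graph_automorphisms X"
    then have fB: "f \<in> Bij (pverts X)" by (simp add: graph_automorphisms_def)
    then have im: "f ` pverts X = pverts X" by (simp add: Bij_def bij_betw_def)
    have "(u, v) \<in> parcs X \<longleftrightarrow> (inv_into (pverts X) f u, inv_into (pverts X) f v) \<in> parcs X"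
      if "u \<in> pverts X" "v \<in> pverts X" for u v
      using f that im inv_into_into[of u f "pverts X"] inv_into_into[of v f "pverts X"]
        f_inv_into_f[of u f "pverts X"] f_inv_into_f[of v f "pverts X"]
      unfolding graph_automorphisms_def by fastforce
    then show "inv\<^bsub>BijGroup (pverts X)\<^esub> f \<in> graph_automorphisms X"
      using fB by (simp add: inv_BijGroup graph_automorphisms_def restrict_inv_into_Bij)
  next
    fix f g assume "f \<in> graph_automorphisms X" "g \<in> graph_automorphisms X"
    then show "f \<otimes>\<^bsub>BijGroup (pverts X)\<^esub> g \<in> graph_automorphisms X"
      using Bij_imp_funcset[of g "pverts X"]
      by (auto simp: graph_automorphisms_def BijGroup_def compose_Bij compose_eq Pi_iff)
  qed
  then show ?thesis
    unfolding graph_aut_group_def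
    by (rule subgroup.subgroup_is_group[OF _ group_BijGroup])
qed

lemma pair_graph_cayley_graph:
  assumes "group H" "finite (carrier H)" "S \<subseteq> carrier H" "\<one>\<^bsub>H\<^esub> \<notin> S" "m_inv H ` S = S"
  shows "pair_graph (cayley_graph H S)"
proof -
  interpret group H by fact
  let ?E = "parcs (cayley_graph H S)"
  have closed: "?E \<subseteq> carrier H \<times> carrier H"
    using assms(3) by (auto simp: cayley_graph_def)
  have irrefl: "u \<noteq> v" if "(u, v) \<in> ?E" for u v
    using that assms(3,4) by (auto simp: cayley_graph_def)
  have symm: "(v, u) \<in> ?E" if "(u, v) \<in> ?E" for u v
  proof -
    from that obtain s where s: "u \<in> carrier H" "s \<in> S" "v = s \<otimes>\<^bsub>H\<^esub> u"
      by (auto simp: cayley_graph_def)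
    then have "u = inv\<^bsub>H\<^esub> s \<otimes>\<^bsub>H\<^esub> v" "v \<in> carrier H" "inv\<^bsub>H\<^esub> s \<in> S"
      using assms(3,5) by (auto simp: m_assoc[symmetric] subset_iff)
    then show ?thesis by (auto simp: cayley_graph_def)
  qed
  have "sym ?E" using symm by (rule symI)
  show ?thesis
  proof
    show "finite (pverts (cayley_graph H S))"
      using assms(2) by (simp add: cayley_graph_def)
    show "finite ?E"
      using closed assms(2) finite_subset by blast
    show "symmetric (with_proj (cayley_graph H S))"
      using \<open>sym ?E\<close> by (simp add: symmetric_def arcs_ends_def arc_to_ends_def)
    fix e assume e: "e \<in> ?E"
    then have "e \<in> carrier H \<times> carrier H" using closed by blast
    then show "fst e \<in> pverts (cayley_graph H S)" "snd e \<in> pverts (cayley_graph H S)"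
      by (auto simp: cayley_graph_def)
    have "(fst e, snd e) \<in> ?E" using e by simp
    then show "fst e \<noteq> snd e" by (rule irrefl)
  qed
qed

lemma pair_graph_modified_bubble_sort_graph:
  assumes "n \<ge> 2"
  shows "pair_graph (modified_bubble_sort_graph n)"
proof -
  let ?S = "cyclic_adjacent_transpositions n"
  have S: "?S \<subseteq> carrier (sym_group n)"
    using assms by (auto simp: cyclic_adjacent_transpositions_def sym_group_def
        intro!: permutes_swap_id)
  have inv: "inv\<^bsub>sym_group n\<^esub> s = s" if "s \<in> ?S" for s
    using that S
    by (intro group.inv_equality[OF sym_group_is_group])
      (auto simp: cyclic_adjacent_transpositions_def sym_group_def)
  have "\<exists>i. s i \<noteq> i" if "s \<in> ?S" for s
  proof -
    from that consider i where "s = Transposition.transpose i (i + 1)"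
      | "s = Transposition.transpose n 1"
      unfolding cyclic_adjacent_transpositions_def by blast
    then show ?thesis
    proof cases
      case (1 i)
      then have "s i \<noteq> i" by simp
      then show ?thesis by blast
    next
      case 2
      then have "s n \<noteq> n" using assms by simp
      then show ?thesis by blast
    qed
  qed
  then have "id \<notin> ?S" by fastforce
  then show ?thesis
    unfolding modified_bubble_sort_graph_def
    using S inv
    by (intro pair_graph_cayley_graph sym_group_is_group)
      (auto simp: sym_group_def finite_permutations)
qed

end

theory Submission
  imports Defs
begin

text \<open>Right translations by \<open>S\<^sub>n\<close> and left translations by the dihedral group, which permutes the
  generators by conjugation, are commuting groups of automorphisms; they intersect trivially because
  \<open>S\<^sub>n\<close> has trivial centre. It remains to see that every automorphism arises in this way.

  Two distinct generators commute iff, as neighbours of the identity, they have a second common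
  neighbour. Hence an automorphism fixing the identity induces an automorphism of the \<open>n\<close>-cycle
  formed by the generators, with non-commutation as adjacency; after composing with a conjugation by
  a dihedral element it fixes every generator. Such an automorphism \<open>f\<close> is trivial: for a generator
  \<open>s\<close>, the map \<open>h \<mapsto> f (h s) s\<close> again fixes the identity, and the cycle automorphism it induces fixes
  \<open>s\<close> and all generators commuting with \<open>s\<close>, since for these \<open>t s\<close> is the second common neighbour of
  \<open>s\<close> and \<open>t\<close>. As \<open>n \<ge> 5\<close>, this forces it to be the identity, so \<open>f\<close> fixes the sphere of radius two.
  By translating and by connectedness \<open>f\<close> fixes every vertex.\<close>

section \<open>The cycle of generators\<close>

definition csuc :: "nat \<Rightarrow> nat \<Rightarrow> nat" where
  "csuc n i = (if i = n then 1 else i + 1)"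

definition gen :: "nat \<Rightarrow> nat \<Rightarrow> nat \<Rightarrow> nat" where
  "gen n i = transpose i (csuc n i)"

definition adj :: "nat \<Rightarrow> (nat \<Rightarrow> nat) \<Rightarrow> (nat \<Rightarrow> nat) \<Rightarrow> bool" where
  "adj n u v \<longleftrightarrow> (\<exists>i\<in>{1..n}. v = gen n i \<circ> u)"

definition cyc_adj :: "nat \<Rightarrow> nat \<Rightarrow> nat \<Rightarrow> bool" where
  "cyc_adj n i j \<longleftrightarrow> j = csuc n i \<or> i = csuc n j"

text \<open>On the finite \<open>n\<close>-cycle an injective self-map that preserves edges is
  already an automorphism; this one-sided form is what the graph argument delivers directly.\<close>

definition cycle_embedding :: "nat \<Rightarrow> (nat \<Rightarrow> nat) \<Rightarrow> bool" where
  "cycle_embedding n \<pi> \<longleftrightarrow> \<pi> ` {1..n} \<subseteq> {1..n} \<and> inj_on \<pi> {1..n} \<and>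
     (\<forall>i\<in>{1..n}. \<forall>j\<in>{1..n}. cyc_adj n i j \<longrightarrow> cyc_adj n (\<pi> i) (\<pi> j))"

text \<open>Differs from membership in \<open>graph_automorphisms\<close> by leaving the values off
  the vertex set free, so that automorphisms can be composed with plain
  \<open>\<circ>\<close>.\<close>

definition cayley_aut :: "nat \<Rightarrow> ((nat \<Rightarrow> nat) \<Rightarrow> nat \<Rightarrow> nat) \<Rightarrow> bool" where
  "cayley_aut n f \<longleftrightarrow> bij_betw f {p. p permutes {1..n}} {p. p permutes {1..n}} \<and>
     (\<forall>u v. u permutes {1..n} \<longrightarrow> v permutes {1..n} \<longrightarrow> adj n u v = adj n (f u) (f v))"

text \<open>Points are residues modulo \<open>n\<close> represented in \<open>{1..n}\<close>: \<open>(x, False)\<close> acts as \<open>a \<mapsto> x + a\<close> and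
  \<open>(x, True)\<close> as \<open>a \<mapsto> x - a\<close>.\<close>

definition dihedral_perm :: "nat \<Rightarrow> int \<times> bool \<Rightarrow> nat \<Rightarrow> nat" where
  "dihedral_perm n d a =
     (if a \<in> {1..n}
      then nat (((if snd d then fst d - int a else fst d + int a) - 1) mod int n) + 1
      else a)"

section \<open>The cyclic successor\<close>

lemma csuc_in: "i \<in> {1..n} \<Longrightarrow> csuc n i \<in> {1..n}"
  by (auto simp: csuc_def)

lemma csuc_inj: "i \<in> {1..n} \<Longrightarrow> j \<in> {1..n} \<Longrightarrow> csuc n i = csuc n j \<longleftrightarrow> i = j"
  by (auto simp: csuc_def)

lemma csuc_surj: "i \<in> {1..n} \<Longrightarrow> \<exists>j\<in>{1..n}. csuc n j = i"
  by (rule bexI[of _ "if i = 1 then n else i - 1"]) (auto simp: csuc_def)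

lemma csuc_no_short_cycle:
  assumes "n \<ge> 5"
  shows "csuc n i \<noteq> i" "csuc n (csuc n i) \<noteq> i" "csuc n (csuc n (csuc n i)) \<noteq> i"
    "csuc n (csuc n (csuc n (csuc n i))) \<noteq> i"
  using assms by (auto simp: csuc_def)

lemma csuc_induct [consumes 1, case_names one step]:
  assumes "i \<in> {1..n}" "P 1" "\<And>i. i \<in> {1..n} \<Longrightarrow> P i \<Longrightarrow> P (csuc n i)"
  shows "P i"
proof -
  have "1 \<le> i \<Longrightarrow> i \<le> n \<Longrightarrow> P i"
  proof (induction i rule: nat_induct_at_least)
    case (Suc m)
    then have "csuc n m = Suc m" "m \<in> {1..n}" by (auto simp: csuc_def)
    then show ?case using assms(3)[of m] Suc by auto
  qed (rule assms(2))
  then show ?thesis using assms(1) by simp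
qed

section \<open>Generators, adjacency and squares through the identity\<close>

lemma gen_permutes: "i \<in> {1..n} \<Longrightarrow> gen n i permutes {1..n}"
  unfolding gen_def using csuc_in by (intro permutes_swap_id) auto

lemma gen_gen [simp]: "gen n i \<circ> gen n i = id"
  by (simp add: gen_def)

lemma gen_gen_comp [simp]: "gen n i \<circ> (gen n i \<circ> p) = p"
  by (simp add: o_assoc)

lemma gen_inj:
  assumes "n \<ge> 5" "i \<in> {1..n}" "j \<in> {1..n}"
  shows "gen n i = gen n j \<longleftrightarrow> i = j"
proof
  assume "gen n i = gen n j"
  then have "gen n j i = csuc n i" "gen n j (csuc n i) = i"
    by (metis gen_def transpose_apply_first transpose_apply_second)+
  then show "i = j" using csuc_no_short_cycle[OF assms(1)]
    unfolding gen_def transpose_def by metis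
qed auto

lemma adj_permutes: "u permutes {1..n} \<Longrightarrow> adj n u v \<Longrightarrow> v permutes {1..n}"
  using gen_permutes permutes_compose[of u "{1..n}"] by (fastforce simp: adj_def)

lemma adj_gen: "i \<in> {1..n} \<Longrightarrow> adj n u (gen n i \<circ> u)"
  by (auto simp: adj_def)

text \<open>Generators multiply on the left, so right translations commute with them and preserve
  adjacency.\<close>

lemma adj_comp_right:
  assumes "p permutes {1..n}"
  shows "adj n (u \<circ> p) (v \<circ> p) \<longleftrightarrow> adj n u v"
proof
  assume "adj n (u \<circ> p) (v \<circ> p)"
  then obtain i where i: "i \<in> {1..n}" "v \<circ> p = gen n i \<circ> (u \<circ> p)" by (auto simp: adj_def)
  then have "v \<circ> p \<circ> inv' p = gen n i \<circ> u \<circ> p \<circ> inv' p" by (simp add: o_assoc)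
  then have "v = gen n i \<circ> u" using permutes_inv_o(1)[OF assms] by (simp add: comp_assoc)
  then show "adj n u v" using i by (auto simp: adj_def)
qed (auto simp: adj_def o_assoc)

text \<open>A product of two distinct generators is a 3-cycle or a double transposition. Of the
  three factorisations of a 3-cycle into two transpositions only one consists of generators; a
  double transposition has just the two orders of its commuting factors.\<close>

lemma gen_products_eqD:
  assumes n: "n \<ge> 5" and I: "i \<in> {1..n}" "j \<in> {1..n}" "a \<in> {1..n}" "b \<in> {1..n}" and "i \<noteq> j"
    and eq: "gen n a \<circ> gen n i = gen n b \<circ> gen n j"
  shows "(a = i \<and> b = j) \<or> (a = j \<and> b = i \<and> \<not> cyc_adj n i j)"
proof -
  have ab: "a \<noteq> b"
    using eq \<open>i \<noteq> j\<close> gen_inj[OF n I(1,2)] by (metis gen_gen_comp)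
  \<comment> \<open>Multiplying by \<open>gen n b\<close> on the left and \<open>gen n i\<close> on
    the right puts \<open>a\<close>, \<open>b\<close> on one side and \<open>i\<close>,
    \<open>j\<close> on the other. Evaluating both sides at the endpoints of the four transpositions
    then decides all cases.\<close>
  have eq': "gen n b \<circ> gen n a = gen n j \<circ> gen n i"
  proof -
    have "gen n b \<circ> (gen n a \<circ> gen n i) \<circ> gen n i = gen n b \<circ> (gen n b \<circ> gen n j) \<circ> gen n i"
      by (simp only: eq)
    then show ?thesis by (simp add: comp_assoc)
  qed
  then have pt: "gen n b (gen n a x) = gen n j (gen n i x)" for x
    by (metis comp_apply)
  note c = csuc_no_short_cycle[OF n]
  have inj: "csuc n x = csuc n y \<longleftrightarrow> x = y" if "x \<in> {i, j, a, b}" "y \<in> {i, j, a, b}" for x y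
    using that I csuc_inj by blast
  show ?thesis
    using pt[of i] pt[of "csuc n i"] pt[of j] pt[of "csuc n j"] pt[of a] pt[of "csuc n a"]
      pt[of b] pt[of "csuc n b"] c[of i] c[of j] c[of a] c[of b] ab \<open>i \<noteq> j\<close>
      inj[of i j] inj[of i a] inj[of i b] inj[of j a] inj[of j b] inj[of a b]
    unfolding gen_def transpose_def cyc_adj_def insert_iff simp_thms
    by (smt (verit))
qed

lemma gens_commute:
  assumes "i \<noteq> j" "i \<in> {1..n}" "j \<in> {1..n}" "\<not> cyc_adj n i j"
  shows "gen n i \<circ> gen n j = gen n j \<circ> gen n i"
  using assms csuc_inj[of i n j]
  by (auto simp: fun_eq_iff gen_def transpose_def cyc_adj_def)

text \<open>A common neighbour of two generators is a solution of
  \<open>gen n a \<circ> gen n i = gen n b \<circ> gen n j\<close>; the solution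
  \<open>a = i\<close>, \<open>b = j\<close> is the identity, and the other one exists exactly for
  commuting generators. Commutation thus becomes a graph property.\<close>

lemma second_common_neighbour:
  assumes n: "n \<ge> 5" and I: "i \<in> {1..n}" "j \<in> {1..n}" "i \<noteq> j"
  shows "x \<noteq> id \<and> adj n (gen n i) x \<and> adj n (gen n j) x \<longleftrightarrow>
    \<not> cyc_adj n i j \<and> x = gen n j \<circ> gen n i"
proof
  assume x: "x \<noteq> id \<and> adj n (gen n i) x \<and> adj n (gen n j) x"
  then obtain a b where ab: "a \<in> {1..n}" "b \<in> {1..n}"
      "x = gen n a \<circ> gen n i" "x = gen n b \<circ> gen n j"
    by (auto simp: adj_def)
  then have "(a = i \<and> b = j) \<or> (a = j \<and> b = i \<and> \<not> cyc_adj n i j)"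
    using gen_products_eqD[OF n I(1,2), of a b] I(3) by metis
  then show "\<not> cyc_adj n i j \<and> x = gen n j \<circ> gen n i" using x ab by auto
next
  assume x: "\<not> cyc_adj n i j \<and> x = gen n j \<circ> gen n i"
  have "x \<noteq> id"
  proof
    assume "x = id"
    then have "gen n j \<circ> (gen n j \<circ> gen n i) = gen n j" using x by simp
    then show False using gen_inj[OF n I(1,2)] I(3) by simp
  qed
  then show "x \<noteq> id \<and> adj n (gen n i) x \<and> adj n (gen n j) x"
    using x I gens_commute[of i j n] by (metis adj_gen)
qed

section \<open>Automorphisms fixing the identity\<close>

lemma cayley_autD:
  assumes "cayley_aut n f"
  shows cayley_aut_permutes: "u permutes {1..n} \<Longrightarrow> f u permutes {1..n}"
    and cayley_aut_adj: "u permutes {1..n} \<Longrightarrow> v permutes {1..n} \<Longrightarrow> adj n (f u) (f v) \<longleftrightarrow> adj n u v"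
    and cayley_aut_inj: "u permutes {1..n} \<Longrightarrow> v permutes {1..n} \<Longrightarrow> f u = f v \<longleftrightarrow> u = v"
    and cayley_aut_surj: "u permutes {1..n} \<Longrightarrow> \<exists>v. v permutes {1..n} \<and> f v = u"
proof -
  have f: "f ` {p. p permutes {1..n}} = {p. p permutes {1..n}}" "inj_on f {p. p permutes {1..n}}"
    using assms by (simp_all add: cayley_aut_def bij_betw_def)
  show "f u permutes {1..n}" if "u permutes {1..n}"
    using f(1) that by blast
  show "adj n (f u) (f v) \<longleftrightarrow> adj n u v" if "u permutes {1..n}" "v permutes {1..n}"
    using assms that by (simp add: cayley_aut_def)
  show "f u = f v \<longleftrightarrow> u = v" if "u permutes {1..n}" "v permutes {1..n}"
    using inj_on_eq_iff[OF f(2)] that by simp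
  show "\<exists>v. v permutes {1..n} \<and> f v = u" if "u permutes {1..n}"
  proof -
    have "u \<in> f ` {p. p permutes {1..n}}" unfolding f(1) using that by simp
    then show ?thesis by blast
  qed
qed

lemma cayley_aut_comp:
  assumes "cayley_aut n f" "cayley_aut n g"
  shows "cayley_aut n (g \<circ> f)"
  using assms cayley_aut_permutes[OF assms(1)] unfolding cayley_aut_def
  by (auto intro: bij_betw_trans)

lemma cayley_aut_right:
  assumes p: "p permutes {1..n}"
  shows "cayley_aut n (\<lambda>h. h \<circ> p)"
proof -
  have "bij_betw (\<lambda>h. h \<circ> p) {p. p permutes {1..n}} {p. p permutes {1..n}}"
    by (rule bij_betw_byWitness[where f' = "\<lambda>h. h \<circ> inv' p"])
      (use p in \<open>auto simp: comp_assoc permutes_inv_o permutes_inv intro: permutes_compose\<close>)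
  then show ?thesis using adj_comp_right[OF p] by (simp add: cayley_aut_def)
qed

lemma cayley_aut_action_on_gens:
  assumes n: "n \<ge> 5" and f: "cayley_aut n f" "f id = id"
  obtains \<pi> where "cycle_embedding n \<pi>" "\<forall>i\<in>{1..n}. f (gen n i) = gen n (\<pi> i)"
proof -
  have "\<forall>i\<in>{1..n}. \<exists>j. j \<in> {1..n} \<and> f (gen n i) = gen n j"
  proof
    fix i assume i: "i \<in> {1..n}"
    then have "adj n id (gen n i)" using adj_gen[of i n id] by simp
    then have "adj n id (f (gen n i))"
      using cayley_aut_adj[OF f(1), of id "gen n i"] i f(2) by (metis permutes_id gen_permutes)
    then show "\<exists>j. j \<in> {1..n} \<and> f (gen n i) = gen n j" by (auto simp: adj_def)
  qed
  then obtain \<pi> where \<pi>: "\<forall>i\<in>{1..n}. \<pi> i \<in> {1..n} \<and> f (gen n i) = gen n (\<pi> i)"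
    by (rule bchoice[THEN exE])
  have inj: "i = j" if "i \<in> {1..n}" "j \<in> {1..n}" "\<pi> i = \<pi> j" for i j
    using that \<pi> cayley_aut_inj[OF f(1), of "gen n i" "gen n j"] gen_inj[OF n, of i j] gen_permutes
    by metis
  have "cyc_adj n (\<pi> i) (\<pi> j)" if ij: "i \<in> {1..n}" "j \<in> {1..n}" "cyc_adj n i j" for i j
  proof (rule ccontr)
    assume non: "\<not> cyc_adj n (\<pi> i) (\<pi> j)"
    have "i \<noteq> j" using ij(3) csuc_no_short_cycle(1)[OF n] unfolding cyc_adj_def by metis
    then have ne: "\<pi> i \<noteq> \<pi> j" using inj ij by blast
    have \<pi>I: "\<pi> i \<in> {1..n}" "\<pi> j \<in> {1..n}" using \<pi> ij by blast+
    \<comment> \<open>If the images commuted, their second common neighbour would pull back along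
      the surjective \<open>f\<close> to one of \<open>gen n i\<close> and \<open>gen n j\<close>,
      which do not commute.\<close>
    obtain y where y: "y \<noteq> id" "adj n (gen n (\<pi> i)) y" "adj n (gen n (\<pi> j)) y"
      using second_common_neighbour[OF n \<pi>I ne] non by blast
    then have "y permutes {1..n}" using adj_permutes gen_permutes \<pi>I by blast
    then obtain x where x: "x permutes {1..n}" "f x = y" using cayley_aut_surj[OF f(1)] by blast
    have "adj n (gen n i) x" "adj n (gen n j) x"
      using y x \<pi> ij cayley_aut_adj[OF f(1)] gen_permutes by metis+
    moreover have "x \<noteq> id" using y x f(2) by blast
    ultimately show False using second_common_neighbour[OF n ij(1,2) \<open>i \<noteq> j\<close>] ij(3) by blast
  qed
  then have "cycle_embedding n \<pi>"
    using \<pi> inj unfolding cycle_embedding_def inj_on_def by blast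
  then show ?thesis using that[of \<pi>] \<pi> by blast
qed

text \<open>Only the two neighbours \<open>j\<close> of \<open>i\<close> are in question. The other
  neighbour of \<open>j\<close> is not adjacent to \<open>i\<close>, hence fixed, and so is
  \<open>i\<close>; \<open>\<pi> j\<close> is adjacent to both, and in a cycle of length at least 5
  their only common neighbour is \<open>j\<close>.\<close>

lemma cycle_embedding_fixing_non_neighbours:
  assumes n: "n \<ge> 5" and i: "i \<in> {1..n}"
    and emb: "cycle_embedding n \<pi>"
    and fix_far: "\<And>j. j \<in> {1..n} \<Longrightarrow> \<not> cyc_adj n i j \<Longrightarrow> \<pi> j = j"
    and j: "j \<in> {1..n}"
  shows "\<pi> j = j"
proof -
  note c = csuc_no_short_cycle[OF n]
  have \<pi>: "\<pi> j \<in> {1..n}" if "j \<in> {1..n}" for j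
    using emb that unfolding cycle_embedding_def by blast
  have adj: "cyc_adj n (\<pi> j) (\<pi> k)" if "j \<in> {1..n}" "k \<in> {1..n}" "cyc_adj n j k" for j k
    using emb that unfolding cycle_embedding_def by blast
  have \<pi>i: "\<pi> i = i" using fix_far[OF i] c(1) unfolding cyc_adj_def by metis
  consider "\<not> cyc_adj n i j" | "j = csuc n i" | "i = csuc n j" by (auto simp: cyc_adj_def)
  then show ?thesis
  proof cases
    case 1 then show ?thesis using fix_far j by blast
  next
    case 2
    let ?k = "csuc n j"
    have k: "?k \<in> {1..n}" using csuc_in j by blast
    have "\<pi> ?k = ?k" using fix_far[OF k] 2 c csuc_inj[OF j i] unfolding cyc_adj_def by metis
    then have "cyc_adj n (\<pi> j) ?k" "cyc_adj n i (\<pi> j)"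
      using adj[OF j k] adj[OF i j] 2 \<pi>i by (auto simp: cyc_adj_def)
    then show ?thesis using 2 c csuc_inj \<pi>[OF j] i j k unfolding cyc_adj_def by metis
  next
    case 3
    obtain k where k: "k \<in> {1..n}" "csuc n k = j" using csuc_surj j by blast
    have "\<pi> k = k" using fix_far[OF k(1)] 3 k c csuc_inj[OF j i] unfolding cyc_adj_def by metis
    then have "cyc_adj n k (\<pi> j)" "cyc_adj n (\<pi> j) i"
      using adj[OF k(1) j] adj[OF j i] 3 k \<pi>i by (auto simp: cyc_adj_def)
    then show ?thesis using 3 c csuc_inj \<pi>[OF j] i j k unfolding cyc_adj_def by metis
  qed
qed

lemma cayley_aut_fixes_sphere_two:
  assumes n: "n \<ge> 5" and f: "cayley_aut n f" "f id = id"
    and fS: "\<And>i. i \<in> {1..n} \<Longrightarrow> f (gen n i) = gen n i"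
    and i: "i \<in> {1..n}" and j: "j \<in> {1..n}"
  shows "f (gen n j \<circ> gen n i) = gen n j \<circ> gen n i"
proof -
  have far: "f (gen n j \<circ> gen n i) = gen n j \<circ> gen n i"
    if j: "j \<in> {1..n}" and "i \<noteq> j" "\<not> cyc_adj n i j" for j
  proof -
    let ?x = "gen n j \<circ> gen n i"
    have x: "?x permutes {1..n}" by (intro permutes_compose gen_permutes i j)
    have "?x \<noteq> id" "adj n (gen n i) ?x" "adj n (gen n j) ?x"
      using second_common_neighbour[OF n i j that(2), of ?x] that(3) by blast+
    then have "f ?x \<noteq> id" "adj n (gen n i) (f ?x)" "adj n (gen n j) (f ?x)"
      using x fS i j f cayley_aut_adj[OF f(1) _ x] gen_permutes cayley_aut_inj[OF f(1) x permutes_id]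
      by metis+
    then show ?thesis using second_common_neighbour[OF n i j that(2), of "f ?x"] by blast
  qed
  \<comment> \<open>Conjugating \<open>f\<close> by the right translation with
    \<open>gen n i\<close> moves the base point from \<open>gen n i\<close> to the identity; as
    \<open>gen n i\<close> is an involution, the same translation leads back.\<close>
  define g where "g = (\<lambda>h. h \<circ> gen n i) \<circ> (f \<circ> (\<lambda>h. h \<circ> gen n i))"
  have g: "cayley_aut n g"
    unfolding g_def by (intro cayley_aut_comp cayley_aut_right gen_permutes i f)
  have g_gen: "g h = f (h \<circ> gen n i) \<circ> gen n i" for h by (simp add: g_def)
  have g_id: "g id = id" using fS[OF i] by (simp add: g_gen)
  obtain \<pi> where \<pi>: "cycle_embedding n \<pi>" "\<forall>i\<in>{1..n}. g (gen n i) = gen n (\<pi> i)"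
    using cayley_aut_action_on_gens[OF n g g_id] by metis
  have "\<pi> k = k" if k: "k \<in> {1..n}" "\<not> cyc_adj n i k" for k
  proof -
    have "g (gen n k) = gen n k"
    \<comment> \<open>For \<open>k = i\<close> the vertex \<open>gen n i \<circ> gen n i\<close> is
      the identity, which \<open>f\<close> fixes; for other \<open>k\<close> the generators commute
      and \<open>far\<close> applies.\<close>
    proof (cases "k = i")
      case True then show ?thesis using f(2) by (simp add: g_gen)
    next
      case False then show ?thesis using far[of k] k by (simp add: g_gen comp_assoc)
    qed
    moreover have "\<pi> k \<in> {1..n}" using \<pi>(1) k(1) unfolding cycle_embedding_def by blast
    ultimately show ?thesis using \<pi>(2) gen_inj[OF n] k(1) by metis
  qed
  then have "\<pi> j = j"
    using cycle_embedding_fixing_non_neighbours[OF n i \<pi>(1) _ j] by blast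
  then have "f (gen n j \<circ> gen n i) \<circ> gen n i = gen n j" using \<pi>(2) j by (metis g_gen)
  then have "f (gen n j \<circ> gen n i) \<circ> gen n i \<circ> gen n i = gen n j \<circ> gen n i" by simp
  then show ?thesis by (simp add: comp_assoc)
qed

text \<open>Connectedness of the graph as an induction principle: each transposition is a product of
  adjacent ones, and transpositions generate the symmetric group.\<close>

lemma permutes_gen_induct [consumes 1, case_names id gen]:
  assumes p: "p permutes {1..n}" and "P id"
    and gen: "\<And>i p. i \<in> {1..n} \<Longrightarrow> p permutes {1..n} \<Longrightarrow> P p \<Longrightarrow> P (gen n i \<circ> p)"
  shows "P p"
proof -
  have ascending: "q permutes {1..n} \<Longrightarrow> P q \<Longrightarrow> P (transpose a b \<circ> q)"
    if "Suc a \<le> b" "1 \<le> a" "b \<le> n" for a b q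
    using that
  proof (induction b arbitrary: q rule: nat_induct_at_least)
    case base
    then have "gen n a = transpose a (Suc a)" by (simp add: gen_def csuc_def)
    then have "P (transpose a (Suc a) \<circ> q)" using gen[of a q] base by simp
    then show ?case .
  next
    case (Suc b)
    have s: "gen n b = transpose b (Suc b)" and b: "b \<in> {1..n}"
      using Suc by (auto simp: gen_def csuc_def)
    \<comment> \<open>The transposition of \<open>a\<close> and \<open>Suc b\<close> is that of
      \<open>a\<close> and \<open>b\<close> conjugated by an adjacent one; the induction hypothesis
      is used at \<open>gen n b \<circ> q\<close>, which is why \<open>q\<close> is
      arbitrary.\<close>
    have "transpose a (Suc b) = gen n b \<circ> (transpose a b \<circ> gen n b)"
      using Suc by (auto simp: s fun_eq_iff transpose_def)
    then have eq: "transpose a (Suc b) \<circ> q = gen n b \<circ> (transpose a b \<circ> (gen n b \<circ> q))"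
      by (simp add: comp_assoc)
    have 1: "gen n b \<circ> q permutes {1..n}" using gen_permutes[OF b] Suc permutes_compose by blast
    have 2: "transpose a b permutes {1..n}" using Suc by (intro permutes_swap_id) auto
    have 3: "P (gen n b \<circ> q)" by (rule gen[OF b Suc.prems(1,2)])
    have "b \<le> n" using Suc.prems(4) by simp
    then have "P (transpose a b \<circ> (gen n b \<circ> q))" by (rule Suc.IH[OF 1 3 Suc.prems(3)])
    then have "P (transpose a (Suc b) \<circ> q)"
      unfolding eq by (rule gen[OF b permutes_compose[OF 1 2]])
    then show ?case .
  qed
  have "P (transpose a b \<circ> q)" if "a \<in> {1..n}" "b \<in> {1..n}" "q permutes {1..n}" "P q" for a b q
  proof (cases a b rule: linorder_cases)
    case less
    then show ?thesis using ascending[of a b q] that by simp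
  next
    case equal
    then show ?thesis using that by simp
  next
    case greater
    then have "P (transpose b a \<circ> q)" using ascending[of b a q] that by simp
    then show ?thesis by (simp only: transpose_commute)
  qed
  note step = this
  show ?thesis
    by (rule permutes_induct[OF p, of P]) (simp, rule \<open>P id\<close>, rule step)
qed

lemma cayley_aut_fixing_ball_eq_id:
  assumes n: "n \<ge> 5" and f: "cayley_aut n f" "f id = id"
    and fS: "\<And>i. i \<in> {1..n} \<Longrightarrow> f (gen n i) = gen n i"
    and p: "p permutes {1..n}"
  shows "f p = p"
proof -
  \<comment> \<open>Strengthened to the ball of radius one around \<open>p\<close>, since fixing
    \<open>p\<close> alone says nothing about its neighbours.\<close>
  have "f p = p \<and> (\<forall>i\<in>{1..n}. f (gen n i \<circ> p) = gen n i \<circ> p)"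
    using p
  proof (induction p rule: permutes_gen_induct)
    case id
    have "f id = id \<and> (\<forall>i\<in>{1..n}. f (gen n i \<circ> id) = gen n i \<circ> id)" using f(2) fS by simp
    then show ?case .
  next
    case (gen i p)
    \<comment> \<open>Translating \<open>p\<close> to the identity turns the induction hypothesis
      into the assumptions of \<open>cayley_aut_fixes_sphere_two\<close>; translated back, its
      conclusion covers the neighbours of \<open>gen n i \<circ> p\<close>.\<close>
    define g where "g = (\<lambda>h. h \<circ> inv' p) \<circ> (f \<circ> (\<lambda>h. h \<circ> p))"
    have g: "cayley_aut n g"
      unfolding g_def by (intro cayley_aut_comp cayley_aut_right permutes_inv gen f)
    have g_eq: "g h = f (h \<circ> p) \<circ> inv' p" for h by (simp add: g_def)
    have fix_p: "f p = p" "\<And>j. j \<in> {1..n} \<Longrightarrow> f (gen n j \<circ> p) = gen n j \<circ> p"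
      using gen.IH by blast+
    have "g id = id" "\<And>j. j \<in> {1..n} \<Longrightarrow> g (gen n j) = gen n j"
      using permutes_inv_o(1)[OF gen(2)] by (simp_all add: g_eq fix_p comp_assoc)
    then have "g (gen n j \<circ> gen n i) \<circ> p = gen n j \<circ> gen n i \<circ> p" if "j \<in> {1..n}" for j
      using cayley_aut_fixes_sphere_two[OF n g _ _ gen(1) that] by simp
    then have "\<forall>j\<in>{1..n}. f (gen n j \<circ> (gen n i \<circ> p)) = gen n j \<circ> (gen n i \<circ> p)"
      using permutes_inv_o(2)[OF gen(2)] by (simp add: g_eq comp_assoc)
    then show ?case using fix_p(2)[OF gen(1)] by blast
  qed
  then show ?thesis by blast
qed

section \<open>The dihedral action\<close>

text \<open>Reduces equations between points to congruences; the residue 0 is represented by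
  \<open>n\<close>, hence the case split in the proof.\<close>

lemma eq_if_mod_eq:
  assumes "a \<in> {1..n}" "b \<in> {1..n}" "int a mod int n = int b mod int n"
  shows "a = b"
proof -
  have "a mod n = b mod n" using assms(3) by (metis of_nat_eq_iff zmod_int)
  then show ?thesis using assms(1,2) by (cases "a = n"; cases "b = n") auto
qed

lemma csuc_mod: "int (csuc n a) mod int n = (int a + 1) mod int n"
  by (simp add: csuc_def add.commute)

lemma dihedral_perm_in: "a \<in> {1..n} \<Longrightarrow> dihedral_perm n d a \<in> {1..n}"
  using pos_mod_bound[of "int n"] by (simp add: dihedral_perm_def Suc_le_eq nat_less_iff)

lemma dihedral_perm_mod:
  assumes "a \<in> {1..n}"
  shows "int (dihedral_perm n (x, e) a) mod int n =
    (if e then x - int a else x + int a) mod int n"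
  using assms by (auto simp: dihedral_perm_def mod_simps)

text \<open>Rotations commute with the successor and reflections reverse it; applying
  \<open>csuc\<close> on both sides of the reflection avoids a predecessor function.\<close>

lemma dihedral_perm_csuc:
  assumes a: "a \<in> {1..n}"
  shows "csuc n (dihedral_perm n (x, False) a) = dihedral_perm n (x, False) (csuc n a)"
    "csuc n (dihedral_perm n (x, True) (csuc n a)) = dihedral_perm n (x, True) a"
proof -
  note c = csuc_in[OF a]
  have "(int (dihedral_perm n (x, False) a) + 1) mod int n = (x + int a + 1) mod int n"
    using dihedral_perm_mod[OF a, of x False] by (metis mod_add_left_eq)
  moreover have "(x + int (csuc n a)) mod int n = (x + (int a + 1)) mod int n"
    using csuc_mod[of n a] by (metis mod_add_right_eq)
  ultimately show "csuc n (dihedral_perm n (x, False) a) = dihedral_perm n (x, False) (csuc n a)"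
    by (intro eq_if_mod_eq[of _ n] csuc_in dihedral_perm_in a)
      (simp add: csuc_mod dihedral_perm_mod[OF c] add.assoc)
  have "(int (dihedral_perm n (x, True) (csuc n a)) + 1) mod int n = (x - int (csuc n a) + 1) mod int n"
    using dihedral_perm_mod[OF c, of x True] by (metis mod_add_left_eq)
  also have "x - int (csuc n a) + 1 = x + 1 - int (csuc n a)" by simp
  also have "(x + 1 - int (csuc n a)) mod int n = (x + 1 - (int a + 1)) mod int n"
    using csuc_mod[of n a] by (metis mod_diff_right_eq)
  finally show "csuc n (dihedral_perm n (x, True) (csuc n a)) = dihedral_perm n (x, True) a"
    by (intro eq_if_mod_eq[of _ n] csuc_in dihedral_perm_in a)
      (simp add: csuc_mod dihedral_perm_mod[OF a])
qed

lemma dihedral_perm_mult: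
  "dihedral_perm n (d \<otimes>\<^bsub>dihedral_group n\<^esub> e) = dihedral_perm n d \<circ> dihedral_perm n e"
proof
  fix a
  obtain x s y t where [simp]: "d = (x, s)" "e = (y, t)" by (cases d; cases e)
  show "dihedral_perm n (d \<otimes>\<^bsub>dihedral_group n\<^esub> e) a = (dihedral_perm n d \<circ> dihedral_perm n e) a"
  proof (cases "a \<in> {1..n}")
    case True
    let ?b = "dihedral_perm n e a"
    have b: "?b \<in> {1..n}" by (rule dihedral_perm_in[OF True])
    have "(x + int ?b) mod int n = (x + (if t then y - int a else y + int a)) mod int n"
      "(x - int ?b) mod int n = (x - (if t then y - int a else y + int a)) mod int n"
      using dihedral_perm_mod[OF True, of y t]
      by (metis mod_add_right_eq \<open>e = (y, t)\<close>, metis mod_diff_right_eq \<open>e = (y, t)\<close>)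
    then have "int (dihedral_perm n (d \<otimes>\<^bsub>dihedral_group n\<^esub> e) a) mod int n =
        int (dihedral_perm n d ?b) mod int n"
      using dihedral_perm_mod[OF b, of x s]
      by (auto simp: dihedral_group_def dihedral_perm_mod[OF True] mod_simps algebra_simps)
    then show ?thesis
      using eq_if_mod_eq dihedral_perm_in[OF True] dihedral_perm_in[OF b] by (metis comp_apply)
  next
    case False
    then show ?thesis by (simp only: dihedral_perm_def comp_apply if_False)
  qed
qed

lemma dihedral_perm_one: "dihedral_perm n \<one>\<^bsub>dihedral_group n\<^esub> = id"
proof
  fix a
  show "dihedral_perm n \<one>\<^bsub>dihedral_group n\<^esub> a = id a"
  proof (cases "a \<in> {1..n}")
    case True
    then show ?thesis
      using eq_if_mod_eq[OF dihedral_perm_in[OF True] True] dihedral_perm_mod[OF True]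
      by (simp add: dihedral_group_def)
  next
    case False
    then show ?thesis by (simp only: dihedral_perm_def id_apply if_False)
  qed
qed

text \<open>Faithfulness of the action: fixing \<open>n\<close>, the residue 0, forces
  \<open>x = 0\<close>, and fixing 1 then excludes a reflection because 1 and -1 differ modulo
  \<open>n\<close>.\<close>

lemma dihedral_perm_eq_id:
  assumes n: "n \<ge> 3" and d: "d \<in> carrier (dihedral_group n)" and id: "dihedral_perm n d = id"
  shows "d = \<one>\<^bsub>dihedral_group n\<^esub>"
proof -
  obtain x e where [simp]: "d = (x, e)" by (cases d)
  have x: "0 \<le> x" "x < int n" using d by (auto simp: dihedral_group_def)
  have "int n mod int n = (if e then x - int n else x + int n) mod int n"
    using dihedral_perm_mod[of n n x e] n id by simp
  then have "x = 0" using x by (auto split: if_splits)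
  moreover have "int 1 mod int n = (if e then x - int 1 else x + int 1) mod int n"
    using dihedral_perm_mod[of 1 n x e] n id by simp
  ultimately have "\<not> e" using n by (auto simp: zmod_minus1)
  then show ?thesis using \<open>x = 0\<close> by (simp add: dihedral_group_def)
qed

lemma dihedral_perm_permutes:
  assumes "n \<ge> 1" and d: "d \<in> carrier (dihedral_group n)"
  shows "dihedral_perm n d permutes {1..n}"
proof -
  interpret D: group "dihedral_group n" by (rule group_dihedral_group[OF assms(1)])
  let ?e = "inv\<^bsub>dihedral_group n\<^esub> d"
  have "dihedral_perm n d \<circ> dihedral_perm n ?e = id" "dihedral_perm n ?e \<circ> dihedral_perm n d = id"
    using d by (simp_all flip: dihedral_perm_mult add: dihedral_perm_one)
  then have "bij (dihedral_perm n d)" by (rule o_bij[rotated])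
  then show ?thesis
    by (auto simp: permutes_def dihedral_perm_def bij_iff)
qed

text \<open>Conjugating a transposition applies the permutation to its endpoints. A reflection
  reverses their cyclic order, so the new index, the earlier endpoint, is the image of
  \<open>csuc n i\<close>.\<close>

lemma dihedral_perm_gen:
  assumes i: "i \<in> {1..n}" and d: "d \<in> carrier (dihedral_group n)"
  shows "dihedral_perm n d \<circ> gen n i =
    gen n (if snd d then dihedral_perm n d (csuc n i) else dihedral_perm n d i) \<circ> dihedral_perm n d"
proof -
  have "n \<ge> 1" using i by auto
  then have inj: "inj (dihedral_perm n d)" using dihedral_perm_permutes[OF _ d] permutes_inj by blast
  obtain x e where [simp]: "d = (x, e)" by (cases d)
  have "gen n (if snd d then dihedral_perm n d (csuc n i) else dihedral_perm n d i) =
      transpose (dihedral_perm n d i) (dihedral_perm n d (csuc n i))"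
    using dihedral_perm_csuc[OF i, of x] by (auto simp: gen_def transpose_commute)
  then show ?thesis
    using inj by (auto simp: fun_eq_iff gen_def transpose_def inj_eq)
qed

lemma cayley_aut_left_dihedral:
  assumes n: "n \<ge> 1" and d: "d \<in> carrier (dihedral_group n)"
  shows "cayley_aut n (\<lambda>h. dihedral_perm n d \<circ> h)"
proof -
  interpret D: group "dihedral_group n" by (rule group_dihedral_group[OF n])
  let ?e = "inv\<^bsub>dihedral_group n\<^esub> d"
  have e: "?e \<in> carrier (dihedral_group n)" using d by simp
  have "dihedral_perm n d \<circ> dihedral_perm n ?e = id" "dihedral_perm n ?e \<circ> dihedral_perm n d = id"
    using d by (simp_all flip: dihedral_perm_mult add: dihedral_perm_one)
  then have inv: "dihedral_perm n d \<circ> (dihedral_perm n ?e \<circ> h) = h"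
    "dihedral_perm n ?e \<circ> (dihedral_perm n d \<circ> h) = h" for h
    by (simp_all add: o_assoc)
  \<comment> \<open>Proved for every group element \<open>a\<close>: the inverse of \<open>d\<close>
    later supplies the converse implication.\<close>
  have adj: "adj n (dihedral_perm n a \<circ> u) (dihedral_perm n a \<circ> v)"
    if a: "a \<in> carrier (dihedral_group n)" and uv: "adj n u v" for a u v
  proof -
    obtain i where i: "i \<in> {1..n}" "v = gen n i \<circ> u" using uv by (auto simp: adj_def)
    let ?j = "if snd a then dihedral_perm n a (csuc n i) else dihedral_perm n a i"
    have "?j \<in> {1..n}" using dihedral_perm_in csuc_in i(1) by auto
    moreover have "dihedral_perm n a \<circ> v = gen n ?j \<circ> (dihedral_perm n a \<circ> u)"
      using dihedral_perm_gen[OF i(1) a] i(2) by (metis comp_assoc)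
    ultimately show ?thesis unfolding adj_def by blast
  qed
  have "dihedral_perm n d permutes {1..n}" "dihedral_perm n ?e permutes {1..n}"
    by (intro dihedral_perm_permutes n d e)+
  note perm = this
  have "bij_betw (\<lambda>h. dihedral_perm n d \<circ> h) {p. p permutes {1..n}} {p. p permutes {1..n}}"
    by (rule bij_betw_byWitness[where f' = "\<lambda>h. dihedral_perm n ?e \<circ> h"])
      (use perm in \<open>auto simp: inv intro: permutes_compose\<close>)
  moreover have "adj n u v \<longleftrightarrow> adj n (dihedral_perm n d \<circ> u) (dihedral_perm n d \<circ> v)" for u v
    using adj[OF d, of u v] adj[OF e, of "dihedral_perm n d \<circ> u" "dihedral_perm n d \<circ> v"]
    unfolding inv(2) by blast
  ultimately show ?thesis by (simp add: cayley_aut_def)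
qed

text \<open>The image of the first edge fixes an orientation, and injectivity forbids turning back,
  so the orientation propagates around the cycle. Here \<open>\<pi>\<close> acts on indices of
  generators, not on points, whence the shift by \<open>csuc\<close> for reflections.\<close>

lemma cycle_embedding_dihedral:
  assumes n: "n \<ge> 5" and emb: "cycle_embedding n \<pi>"
  obtains d where "d \<in> carrier (dihedral_group n)"
    "\<forall>i\<in>{1..n}. \<pi> i = (if snd d then dihedral_perm n d (csuc n i) else dihedral_perm n d i)"
proof -
  have \<pi>: "\<pi> i \<in> {1..n}" if "i \<in> {1..n}" for i
    using emb that unfolding cycle_embedding_def by blast
  have adj: "cyc_adj n (\<pi> i) (\<pi> j)" if "i \<in> {1..n}" "j \<in> {1..n}" "cyc_adj n i j" for i j
    using emb that unfolding cycle_embedding_def by blast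
  have inj: "i = j" if "i \<in> {1..n}" "j \<in> {1..n}" "\<pi> i = \<pi> j" for i j
    using emb that unfolding cycle_embedding_def by (meson inj_onD)
  note c = csuc_no_short_cycle[OF n]
  have one_in: "1 \<in> {1..n}" using n by simp
  have turn: "\<pi> i \<noteq> \<pi> (csuc n (csuc n i))" if "i \<in> {1..n}" for i
    using inj[OF that csuc_in[OF csuc_in[OF that]]] c(2)[of i] by metis
  have edge: "cyc_adj n (\<pi> i) (\<pi> (csuc n i))" if "i \<in> {1..n}" for i
    using adj[OF that csuc_in[OF that]] by (simp add: cyc_adj_def)
  have "cyc_adj n (\<pi> 1) (\<pi> (csuc n 1))" by (rule edge[OF one_in])
  then consider (rot) "\<pi> (csuc n 1) = csuc n (\<pi> 1)" | (ref) "\<pi> 1 = csuc n (\<pi> (csuc n 1))"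
    by (auto simp: cyc_adj_def)
  then show ?thesis
  proof cases
    case rot
    have succ: "\<pi> (csuc n i) = csuc n (\<pi> i)" if "i \<in> {1..n}" for i
      using that
    proof (induction i rule: csuc_induct)
      case (step i)
      then show ?case using \<pi> turn[of i] edge[of "csuc n i"] csuc_in csuc_inj
        unfolding cyc_adj_def by metis
    qed (rule rot)
    \<comment> \<open>The rotation taking 1 to \<open>\<pi> 1\<close>.\<close>
    define d where "d = ((int (\<pi> 1) - 1) mod int n, False)"
    have d: "d \<in> carrier (dihedral_group n)" using n by (simp add: d_def dihedral_group_def)
    have "\<pi> i = dihedral_perm n d i" if "i \<in> {1..n}" for i
      using that
    proof (induction i rule: csuc_induct)
      case one
      have "int (\<pi> 1) mod int n = int (dihedral_perm n d 1) mod int n"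
        unfolding d_def dihedral_perm_mod[OF one_in] by (simp add: mod_simps)
      then show ?case using eq_if_mod_eq \<pi>[OF one_in] dihedral_perm_in[OF one_in] by metis
    next
      case (step i)
      then show ?case using succ dihedral_perm_csuc(1)[of i n] by (simp add: d_def)
    qed
    moreover have "\<not> snd d" by (simp add: d_def)
    ultimately have "\<forall>i\<in>{1..n}. \<pi> i = (if snd d then dihedral_perm n d (csuc n i) else dihedral_perm n d i)"
      by metis
    with d show ?thesis by (rule that)
  next
    case ref
    have pred: "\<pi> i = csuc n (\<pi> (csuc n i))" if "i \<in> {1..n}" for i
      using that
    proof (induction i rule: csuc_induct)
      case (step i)
      then have "\<pi> (csuc n (csuc n i)) \<noteq> csuc n (\<pi> (csuc n i))" using turn[of i] by metis
      then show ?case using edge[OF csuc_in[OF step(1)]] unfolding cyc_adj_def by blast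
    qed (rule ref)
    \<comment> \<open>The reflection taking 2, the successor of 1, to \<open>\<pi> 1\<close>:
      \<open>x - 2\<close> must be congruent to \<open>\<pi> 1\<close>.\<close>
    define d where "d = ((int (\<pi> 1) + 2) mod int n, True)"
    have d: "d \<in> carrier (dihedral_group n)" using n by (simp add: d_def dihedral_group_def)
    have "\<pi> i = dihedral_perm n d (csuc n i)" if "i \<in> {1..n}" for i
      using that
    proof (induction i rule: csuc_induct)
      case one
      have two: "csuc n 1 = 2" "2 \<in> {1..n}" using n by (simp_all add: csuc_def)
      have "int (\<pi> 1) mod int n = int (dihedral_perm n d 2) mod int n"
        unfolding d_def dihedral_perm_mod[OF two(2)] by (simp add: mod_simps)
      then show ?case
        using eq_if_mod_eq \<pi>[OF one_in] dihedral_perm_in[OF two(2)] two(1) by metis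
    next
      case (step i)
      let ?j = "csuc n i"
      have j: "?j \<in> {1..n}" "csuc n ?j \<in> {1..n}" using step csuc_in by blast+
      have "csuc n (\<pi> ?j) = csuc n (dihedral_perm n d (csuc n ?j))"
        using pred[OF step(1)] step(2) dihedral_perm_csuc(2)[OF j(1)] unfolding d_def by metis
      then show ?case using csuc_inj \<pi> j dihedral_perm_in by metis
    qed
    moreover have "snd d" by (simp add: d_def)
    ultimately have "\<forall>i\<in>{1..n}. \<pi> i = (if snd d then dihedral_perm n d (csuc n i) else dihedral_perm n d i)"
      by metis
    with d show ?thesis by (rule that)
  qed
qed

text \<open>A right translation makes the automorphism fix the identity, and conjugation by a
  dihedral element makes it fix every generator as well; what remains is the identity map, and
  undoing both corrections gives the formula.\<close>

lemma cayley_aut_form: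
  assumes n: "n \<ge> 5" and f: "cayley_aut n f"
  obtains g d where "g permutes {1..n}" "d \<in> carrier (dihedral_group n)"
    "\<And>h. h permutes {1..n} \<Longrightarrow> f h = dihedral_perm n d \<circ> h \<circ> inv' g"
proof -
  interpret D: group "dihedral_group n" using n by (intro group_dihedral_group) simp
  have F: "f id permutes {1..n}" by (rule cayley_aut_permutes[OF f permutes_id])
  define f1 where "f1 = (\<lambda>h. h \<circ> inv' (f id)) \<circ> f"
  have f1: "cayley_aut n f1"
    unfolding f1_def by (intro cayley_aut_comp cayley_aut_right permutes_inv F f)
  have f1_id: "f1 id = id" using permutes_inv_o(1)[OF F] by (simp add: f1_def)
  obtain \<pi> where \<pi>: "cycle_embedding n \<pi>" "\<forall>i\<in>{1..n}. f1 (gen n i) = gen n (\<pi> i)"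
    using cayley_aut_action_on_gens[OF n f1 f1_id] by metis
  obtain d where d: "d \<in> carrier (dihedral_group n)"
    "\<forall>i\<in>{1..n}. \<pi> i = (if snd d then dihedral_perm n d (csuc n i) else dihedral_perm n d i)"
    using cycle_embedding_dihedral[OF n \<pi>(1)] by metis
  let ?D = "dihedral_perm n d" and ?e = "inv\<^bsub>dihedral_group n\<^esub> d"
  let ?E = "dihedral_perm n ?e"
  have e: "?e \<in> carrier (dihedral_group n)" using d by simp
  have D: "?D permutes {1..n}" using n d(1) by (intro dihedral_perm_permutes) auto
  have DE: "?D \<circ> ?E = id" "?E \<circ> ?D = id"
    using d by (simp_all flip: dihedral_perm_mult add: dihedral_perm_one)
  then have DE': "?D \<circ> (?E \<circ> h) = h" "?E \<circ> (?D \<circ> h) = h" for h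
    by (simp_all add: o_assoc)
  define f2 where "f2 = (\<lambda>h. ?E \<circ> h) \<circ> ((\<lambda>h. h \<circ> ?D) \<circ> f1)"
  have f2: "cayley_aut n f2"
    unfolding f2_def using n
    by (intro cayley_aut_comp cayley_aut_right cayley_aut_left_dihedral D e f1) simp
  have f2_eq: "f2 h = ?E \<circ> (f1 h \<circ> ?D)" for h by (simp add: f2_def)
  have "f2 id = id" by (simp add: f2_eq f1_id DE)
  moreover have "f2 (gen n i) = gen n i" if i: "i \<in> {1..n}" for i
  proof -
    have "f1 (gen n i) \<circ> ?D = ?D \<circ> gen n i"
      using dihedral_perm_gen[OF i d(1)] \<pi>(2) d(2) i by metis
    then show ?thesis by (simp add: f2_eq DE')
  qed
  ultimately have fix2: "f2 h = h" if "h permutes {1..n}" for h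
    using cayley_aut_fixing_ball_eq_id[OF n f2] that by blast
  \<comment> \<open>Solving \<open>f2 h = h\<close> for \<open>f h\<close> gives
    \<open>?D \<circ> h \<circ> ?E \<circ> f id\<close>, so \<open>g\<close> is the inverse of
    \<open>?E \<circ> f id\<close>.\<close>
  define g where "g = inv' (f id) \<circ> ?D"
  have g: "g permutes {1..n}" unfolding g_def by (intro permutes_compose D permutes_inv F)
  have "f h \<circ> g = ?D \<circ> h" if "h permutes {1..n}" for h
    using DE'(1)[of "f1 h \<circ> ?D"] fix2[OF that] by (simp add: f2_eq f1_def g_def comp_assoc)
  then have "f h \<circ> g \<circ> inv' g = ?D \<circ> h \<circ> inv' g" if "h permutes {1..n}" for h
    using that by simp
  then have "f h = ?D \<circ> h \<circ> inv' g" if "h permutes {1..n}" for h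
    using that permutes_inv_o(1)[OF g] by (simp add: comp_assoc)
  then show ?thesis using that g d(1) by blast
qed

section \<open>The isomorphism\<close>

text \<open>If \<open>z\<close> moves \<open>a\<close>, choose a third point \<open>b\<close>. The
  transposition of \<open>z a\<close> and \<open>b\<close> fixes \<open>a\<close> but moves
  \<open>z a\<close>, so it cannot commute with \<open>z\<close>.\<close>

lemma permutes_central_eq_id:
  fixes z :: "nat \<Rightarrow> nat"
  assumes n: "n \<ge> 3" and z: "z permutes {1..n}"
    and comm: "\<And>h. h permutes {1..n} \<Longrightarrow> z \<circ> h = h \<circ> z"
  shows "z = id"
proof (rule ccontr)
  assume "z \<noteq> id"
  then obtain a where a: "z a \<noteq> a" by (auto simp: fun_eq_iff)
  then have aI: "a \<in> {1..n}" "z a \<in> {1..n}" using z permutes_not_in permutes_in_image[OF z] by metis+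
  have "card {a, z a} < card {1..n}" using n a by simp
  then have "\<not> {1..n} \<subseteq> {a, z a}" by (metis card_mono finite.emptyI finite.insertI not_le)
  then obtain b where b: "b \<in> {1..n}" "b \<noteq> a" "b \<noteq> z a" by blast
  have "transpose (z a) b permutes {1..n}" by (rule permutes_swap_id[OF aI(2) b(1)])
  from comm[OF this] have "z (transpose (z a) b a) = transpose (z a) b (z a)"
    by (metis comp_apply)
  then show False using a b by (simp add: transpose_def split: if_splits)
qed

section \<open>Transfer to the modified bubble-sort graph\<close>

lemma cyclic_adjacent_transpositions_eq:
  assumes "n \<ge> 1"
  shows "cyclic_adjacent_transpositions n = gen n ` {1..n}"
proof -
  have "{1..n} = insert n {i. 1 \<le> i \<and> i < n}" using assms by auto
  moreover have "gen n ` {i. 1 \<le> i \<and> i < n} = {transpose i (i + 1) | i. 1 \<le> i \<and> i < n}"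
    by (force simp: gen_def csuc_def)
  moreover have "gen n n = transpose n 1" by (simp add: gen_def csuc_def)
  ultimately show ?thesis unfolding cyclic_adjacent_transpositions_def by simp
qed

lemma pverts_modified_bubble_sort_graph:
  "pverts (modified_bubble_sort_graph n) = {p. p permutes {1..n}}"
  by (simp add: modified_bubble_sort_graph_def cayley_graph_def sym_group_def)

lemma parcs_modified_bubble_sort_graph:
  assumes "n \<ge> 1" "u permutes {1..n}"
  shows "(u, v) \<in> parcs (modified_bubble_sort_graph n) \<longleftrightarrow> adj n u v"
  using assms by (auto simp: modified_bubble_sort_graph_def cayley_graph_def sym_group_def adj_def
      cyclic_adjacent_transpositions_eq)

lemma graph_automorphisms_modified_bubble_sort_graph:
  assumes "n \<ge> 1"
  shows "f \<in> graph_automorphisms (modified_bubble_sort_graph n) \<longleftrightarrow>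
    f \<in> extensional {p. p permutes {1..n}} \<and> cayley_aut n f"
proof -
  have "f u permutes {1..n}" if "f \<in> Bij {p. p permutes {1..n}}" "u permutes {1..n}" for u
    using that Bij_imp_funcset by blast
  then show ?thesis
    using parcs_modified_bubble_sort_graph[OF assms]
    unfolding graph_automorphisms_def pverts_modified_bubble_sort_graph cayley_aut_def Bij_def
    by auto
qed

lemma cayley_aut_restrict:
  "cayley_aut n (restrict f {p. p permutes {1..n}}) \<longleftrightarrow> cayley_aut n f"
proof -
  have "bij_betw (restrict f {p. p permutes {1..n}}) {p. p permutes {1..n}} {p. p permutes {1..n}} =
      bij_betw f {p. p permutes {1..n}} {p. p permutes {1..n}}"
    by (rule bij_betw_cong) simp
  then show ?thesis unfolding cayley_aut_def by simp
qed

text \<open>Inverting \<open>g\<close> makes the right action a homomorphism; the restriction makes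
  the values extensional, as elements of \<open>BijGroup\<close> must be.\<close>

definition two_sided :: "nat \<Rightarrow> (nat \<Rightarrow> nat) \<times> int \<times> bool \<Rightarrow> (nat \<Rightarrow> nat) \<Rightarrow> nat \<Rightarrow> nat" where
  "two_sided n = (\<lambda>(g, d). \<lambda>h\<in>{p. p permutes {1..n}}. dihedral_perm n d \<circ> h \<circ> inv' g)"

lemma two_sided_hom:
  assumes n: "n \<ge> 1"
  shows "two_sided n \<in> hom (sym_group n \<times>\<times> dihedral_group n)
    (graph_aut_group (modified_bubble_sort_graph n))"
proof -
  let ?P = "{p. p permutes {1..n}}" and ?X = "modified_bubble_sort_graph n"
  have aut: "two_sided n (g, d) \<in> graph_automorphisms ?X"
    if "g permutes {1..n}" "d \<in> carrier (dihedral_group n)" for g d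
  proof -
    have "cayley_aut n ((\<lambda>h. h \<circ> inv' g) \<circ> (\<lambda>h. dihedral_perm n d \<circ> h))"
      by (intro cayley_aut_comp cayley_aut_right cayley_aut_left_dihedral permutes_inv that n)
    moreover have "(\<lambda>h. h \<circ> inv' g) \<circ> (\<lambda>h. dihedral_perm n d \<circ> h) =
        (\<lambda>h. dihedral_perm n d \<circ> h \<circ> inv' g)"
      by (simp add: fun_eq_iff)
    ultimately have "cayley_aut n (two_sided n (g, d))"
      unfolding two_sided_def prod.case cayley_aut_restrict by metis
    then show ?thesis
      unfolding graph_automorphisms_modified_bubble_sort_graph[OF n]
      by (simp add: two_sided_def)
  qed
  have mult: "two_sided n (g \<circ> g', d \<otimes>\<^bsub>dihedral_group n\<^esub> d') =
      two_sided n (g, d) \<otimes>\<^bsub>graph_aut_group ?X\<^esub> two_sided n (g', d')"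
    if g: "g permutes {1..n}" "g' permutes {1..n}"
      and d: "d \<in> carrier (dihedral_group n)" "d' \<in> carrier (dihedral_group n)" for g g' d d'
  proof -
    have "two_sided n (g, d) \<in> Bij ?P" "two_sided n (g', d') \<in> Bij ?P"
      using aut[OF g(1) d(1)] aut[OF g(2) d(2)]
      by (auto simp: graph_automorphisms_def pverts_modified_bubble_sort_graph)
    moreover have "dihedral_perm n d' \<circ> h \<circ> inv' g' permutes {1..n}" if "h permutes {1..n}" for h
      using that n g d by (intro permutes_compose dihedral_perm_permutes permutes_inv)
    moreover have "inv' (g \<circ> g') = inv' g' \<circ> inv' g"
      using g by (intro o_inv_distrib permutes_bij)
    ultimately show ?thesis
      by (auto simp: graph_aut_group_def BijGroup_def pverts_modified_bubble_sort_graph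
          two_sided_def compose_def dihedral_perm_mult comp_assoc restrict_def fun_eq_iff)
  qed
  show ?thesis
    using aut mult by (auto simp: hom_def DirProd_def sym_group_def graph_aut_group_def)
qed

theorem theorem1:
  fixes n :: nat
  assumes "n \<ge> 5"
  shows "graph_aut_group (modified_bubble_sort_graph n) \<cong> sym_group n \<times>\<times> dihedral_group n"
proof -
  let ?P = "{p. p permutes {1..n}}" and ?X = "modified_bubble_sort_graph n"
  let ?G = "sym_group n \<times>\<times> dihedral_group n" and ?A = "graph_aut_group ?X"
  have n: "n \<ge> 1" "n \<ge> 3" using assms by auto
  interpret G: group ?G
    by (intro DirProd_group sym_group_is_group group_dihedral_group n)
  interpret A: group ?A by (rule group_graph_aut_group)
  interpret group_hom ?G ?A "two_sided n"
    by unfold_locales (rule two_sided_hom[OF n(1)])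
  have "inj_on (two_sided n) (carrier ?G)"
    unfolding inj_on_one_iff
  proof (intro allI impI)
    fix x assume x: "x \<in> carrier ?G" and one: "two_sided n x = \<one>\<^bsub>?A\<^esub>"
    obtain g d where [simp]: "x = (g, d)" by (cases x)
    have g: "g permutes {1..n}" and d: "d \<in> carrier (dihedral_group n)"
      using x by (auto simp: sym_group_def)
    have "dihedral_perm n d \<circ> h \<circ> inv' g = h" if "h permutes {1..n}" for h
      using fun_cong[OF one, of h] that
      by (simp add: two_sided_def graph_aut_group_def BijGroup_def pverts_modified_bubble_sort_graph)
    then have "dihedral_perm n d \<circ> h \<circ> inv' g \<circ> g = h \<circ> g" if "h permutes {1..n}" for h
      using that by simp
    then have comm: "dihedral_perm n d \<circ> h = h \<circ> g" if "h permutes {1..n}" for h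
      using that permutes_inv_o(2)[OF g] by (simp add: comp_assoc)
    \<comment> \<open>At the identity the relation says that the left and right factors agree;
      \<open>comm\<close> then makes \<open>g\<close> central, hence trivial, and faithfulness of
      the dihedral action gives \<open>d\<close>.\<close>
    from comm[of id] have g_eq: "g = dihedral_perm n d" by (simp add: permutes_id)
    then have "g = id" using permutes_central_eq_id[OF n(2) g] comm by simp
    moreover have "d = \<one>\<^bsub>dihedral_group n\<^esub>"
      using dihedral_perm_eq_id[OF n(2) d] g_eq \<open>g = id\<close> by simp
    ultimately show "x = \<one>\<^bsub>?G\<^esub>" by (simp add: sym_group_def)
  qed
  moreover have "carrier ?A \<subseteq> two_sided n ` carrier ?G"
  proof
    fix f assume "f \<in> carrier ?A"
    then have f: "f \<in> extensional ?P" "cayley_aut n f"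
      using graph_automorphisms_modified_bubble_sort_graph[OF n(1)]
      by (auto simp: graph_aut_group_def)
    obtain g d where gd: "g permutes {1..n}" "d \<in> carrier (dihedral_group n)"
      "\<And>h. h permutes {1..n} \<Longrightarrow> f h = dihedral_perm n d \<circ> h \<circ> inv' g"
      using cayley_aut_form[OF assms f(2)] by blast
    have "f = two_sided n (g, d)"
      using f(1) gd(3) by (intro extensionalityI[of _ ?P]) (auto simp: two_sided_def)
    then show "f \<in> two_sided n ` carrier ?G" using gd by (auto simp: sym_group_def)
  qed
  ultimately have "two_sided n \<in> iso ?G ?A"
    using homh hom_closed by (auto simp: iso_def bij_betw_def)
  then have "?G \<cong> ?A" by (rule is_isoI)
  then show ?thesis by (rule G.iso_sym)
qed

end
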